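(* The spectra of the linear operators $\mathrm{fix}$ and $\mathrm{orb}$ on $\mathcal{A}=\mathbb{C}^{\mathbb{N}}$ are $$\mathrm{spec}(\mathrm{fix})=\mathbb{N}\qquad\text{and}\qquad \mathrm{spec}(\mathrm{orb})=\left\{\tfrac{1}{N}\;\middle|\; N\in\mathbb{N}\right\}.$$
   Context: $\mathbb{N}=\{1,2,3,\ldots\}$. $\mathcal{A}=\mathbb{C}^{\mathbb{N}}$ is the complex vector space of all arithmetic functions (sequences of complex numbers indexed by $\mathbb{N}$), with component-wise operations. The linear maps $\mathrm{fix},\mathrm{orb}:\mathcal{A}\to\mathcal{A}$ are defined by $$\mathrm{fix}(a)_n=\sum_{d\mid n} d\,a_d,\qquad \mathrm{orb}(a)_n=\frac1n\sum_{d\mid n}\mu\!\left(\frac nd\right)a_d\qquad(n\in\mathbb{N}),$$ where sums run over positive divisors and $\mu$ is the Möbius function. For a linear operator $T:\mathcal{A}\to\mathcal{A}$, the spectrum is the purely algebraic notion $\mathrm{spec}(T)=\{\lambda\in\mathbb{C}\mid T-\lambda\,\mathrm{id}\text{ is not invertible}\}$, where invertible means bijective as a map $\mathcal{A}\to\mathcal{A}$ (no topology involved). *)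

theory Defs
  imports
    Complex_Main
    "HOL-Library.Function_Algebras"
    "HOL-Computational_Algebra.Squarefree"
begin

text \<open>The index set is \<open>{1, 2, 3, ...}\<close>; it is a type of its own so that \<open>\<complex>\<^sup>\<nat>\<close> is a full function type
  and invertibility of an operator is plain bijectivity, without junk values at index \<open>0\<close>.\<close>

typedef posnat = "{n :: nat. 0 < n}"
  morphisms nat_of_posnat Abs_posnat
  by (rule exI[of _ 1]) simp

lemma nat_of_posnat_pos: "0 < nat_of_posnat n"
  using nat_of_posnat[of n] by simp

type_synonym arith_fun = "posnat \<Rightarrow> complex"

definition scale_af :: "complex \<Rightarrow> arith_fun \<Rightarrow> arith_fun" where
  "scale_af c a = (\<lambda>n. c * a n)"

definition divisors_of :: "posnat \<Rightarrow> posnat set" where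
  "divisors_of n = {d. nat_of_posnat d dvd nat_of_posnat n}"

definition moebius :: "nat \<Rightarrow> int" where
  "moebius n = (if squarefree n then (- 1) ^ card (prime_factors n) else 0)"

definition fix_op :: "arith_fun \<Rightarrow> arith_fun" where
  "fix_op a = (\<lambda>n. \<Sum>d\<in>divisors_of n. of_nat (nat_of_posnat d) * a d)"

definition orb_op :: "arith_fun \<Rightarrow> arith_fun" where
  "orb_op a = (\<lambda>n. 1 / of_nat (nat_of_posnat n) *
     (\<Sum>d\<in>divisors_of n. of_int (moebius (nat_of_posnat n div nat_of_posnat d)) * a d))"

definition spectrum :: "(arith_fun \<Rightarrow> arith_fun) \<Rightarrow> complex set" where
  "spectrum T = {c. \<not> bij (\<lambda>a. T a - scale_af c a)}"

lemma finite_divisors_of: "finite (divisors_of n)"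
proof (rule inj_on_finite[where f = nat_of_posnat and B = "{..nat_of_posnat n}"])
  show "inj_on nat_of_posnat (divisors_of n)"
    by (simp add: inj_on_def nat_of_posnat_inject)
  show "nat_of_posnat ` divisors_of n \<subseteq> {..nat_of_posnat n}"
    by (auto simp: divisors_of_def nat_of_posnat_pos intro: dvd_imp_le)
qed simp

lemma vector_space_scale_af: "vector_space scale_af"
  by unfold_locales (auto simp: scale_af_def fun_eq_iff algebra_simps)

lemma linear_fix_op: "Vector_Spaces.linear scale_af scale_af fix_op"
  using vector_space_scale_af
  by (auto simp: Vector_Spaces.linear_iff scale_af_def fix_op_def fun_eq_iff
        algebra_simps sum.distrib sum_distrib_left)

lemma linear_orb_op: "Vector_Spaces.linear scale_af scale_af orb_op"
  using vector_space_scale_af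
  by (auto simp: Vector_Spaces.linear_iff scale_af_def orb_op_def fun_eq_iff
        algebra_simps add_divide_distrib sum.distrib sum_distrib_left sum_divide_distrib)

end

theory Submission
  imports Defs
begin

text \<open>With respect to divisibility both operators are lower triangular infinite matrices. Such a
  matrix is invertible iff its diagonal has no zero: forward substitution solves the system if there
  is none, and if \<open>m\<close> is the first index with a zero on the diagonal, the unit vector at \<open>m\<close>
  is not in the image, because forward substitution forces the solution to vanish before \<open>m\<close>.
  So the spectrum is the set of diagonal entries.\<close>

text \<open>\<open>k n d\<close> is the matrix entry in row \<open>n\<close> and column
  \<open>d\<close>; only columns \<open>d\<close> dividing \<open>n\<close> are read, which makes
  the matrix triangular.\<close>

definition tri_op :: "(posnat \<Rightarrow> posnat \<Rightarrow> complex) \<Rightarrow> arith_fun \<Rightarrow> arith_fun" where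
  "tri_op k a = (\<lambda>n. \<Sum>d\<in>divisors_of n. k n d * a d)"

lemma self_in_divisors_of: "n \<in> divisors_of n"
  by (simp add: divisors_of_def)

lemma proper_divisor_less:
  assumes "d \<in> divisors_of n - {n}"
  shows "nat_of_posnat d < nat_of_posnat n"
proof -
  have "nat_of_posnat d \<le> nat_of_posnat n"
    using assms by (auto simp: divisors_of_def nat_of_posnat_pos intro: dvd_imp_le)
  moreover have "nat_of_posnat d \<noteq> nat_of_posnat n"
    using assms by (auto simp: nat_of_posnat_inject)
  ultimately show ?thesis by simp
qed

lemma tri_op_split:
  "tri_op k a n = k n n * a n + (\<Sum>d\<in>divisors_of n - {n}. k n d * a d)"
  unfolding tri_op_def
  by (rule sum.remove[OF finite_divisors_of self_in_divisors_of])

text \<open>Forward substitution: row \<open>n\<close> is solved for the unknown at \<open>n\<close>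
  once those at the proper divisors are known. The value is a solution only where
  \<open>k n n\<close> is nonzero.\<close>

function tri_solve :: "(posnat \<Rightarrow> posnat \<Rightarrow> complex) \<Rightarrow> arith_fun \<Rightarrow> arith_fun" where
  "tri_solve k b n =
     (b n - (\<Sum>d\<in>divisors_of n - {n}. k n d * tri_solve k b d)) / k n n"
  by auto
termination
  by (relation "measure (\<lambda>(k, b, n). nat_of_posnat n)") (auto intro: proper_divisor_less)

declare tri_solve.simps [simp del]

lemma tri_op_tri_solve:
  assumes "\<And>n. k n n \<noteq> 0"
  shows "tri_op k (tri_solve k b) = b"
proof
  fix n
  show "tri_op k (tri_solve k b) n = b n"
    using assms[of n] by (simp add: tri_op_split tri_solve.simps[of k b n])
qed

text \<open>Induction along proper divisors, which are smaller. Both assumptions stop at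
  \<open>n\<close>, so that the lemma still applies below the first zero of the diagonal.\<close>

lemma tri_op_determines:
  assumes "\<And>j. nat_of_posnat j \<le> nat_of_posnat n \<Longrightarrow> k j j \<noteq> 0"
    and "\<And>j. nat_of_posnat j \<le> nat_of_posnat n \<Longrightarrow> tri_op k a j = tri_op k b j"
  shows "a n = b n"
  using assms
proof (induction n rule: measure_induct_rule[of nat_of_posnat])
  case (less n)
  have "a d = b d" if "d \<in> divisors_of n - {n}" for d
    using less proper_divisor_less[OF that] by auto
  then have "(\<Sum>d\<in>divisors_of n - {n}. k n d * a d) = (\<Sum>d\<in>divisors_of n - {n}. k n d * b d)"
    by simp
  with less.prems(2)[of n] have "k n n * a n = k n n * b n"
    by (simp add: tri_op_split)
  then show ?case
    using less.prems(1)[of n] by simp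
qed

lemma tri_op_not_surj:
  assumes "k m m = 0"
  shows "\<not> surj (tri_op k)"
proof
  assume "surj (tri_op k)"
  define P where "P = (\<lambda>n. k n n = 0)"
  \<comment> \<open>The given zero is replaced by the least one, under the same name.\<close>
  define m where "m = arg_min nat_of_posnat P"
  have P_m: "P m"
    unfolding m_def by (rule arg_min_natI[of P]) (use assms in \<open>simp add: P_def\<close>)
  have nonzero: "k j j \<noteq> 0" if "nat_of_posnat j < nat_of_posnat m" for j
    using that arg_min_nat_le[of P j nat_of_posnat] by (auto simp: P_def m_def)
  obtain a where a: "tri_op k a = (\<lambda>n. if n = m then 1 else 0)"
    using \<open>surj (tri_op k)\<close> by (metis surjD)
  have "a d = 0" if "d \<in> divisors_of m - {m}" for d
  proof -
    have "d \<noteq> m" "nat_of_posnat d < nat_of_posnat m"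
      using that proper_divisor_less by auto
    then show ?thesis
      \<comment> \<open>The rows up to \<open>d\<close> lie before \<open>m\<close>, so their
        right-hand side is 0, as it is for the zero function.\<close>
      using nonzero a by (intro tri_op_determines[where k = k and b = "\<lambda>_. 0"]) (auto simp: tri_op_def)
  qed
  then have "tri_op k a m = 0"
    using P_m by (simp add: tri_op_split P_def)
  then show False
    by (simp add: a)
qed

lemma bij_tri_op_iff: "bij (tri_op k) \<longleftrightarrow> (\<forall>n. k n n \<noteq> 0)"
proof
  assume "bij (tri_op k)"
  then show "\<forall>n. k n n \<noteq> 0"
    using tri_op_not_surj[of k] by (auto simp only: bij_def)
next
  assume nonzero: "\<forall>n. k n n \<noteq> 0"
  have "inj (tri_op k)"
  proof (intro injI ext)
    fix a b n
    assume "tri_op k a = tri_op k b"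
    with nonzero show "a n = b n"
      by (simp add: tri_op_determines[of n k a b])
  qed
  moreover have "surj (tri_op k)"
    using nonzero by (intro surjI[where g = "tri_op k" and f = "tri_solve k"] tri_op_tri_solve) simp
  ultimately show "bij (tri_op k)"
    by (simp add: bij_def)
qed

text \<open>Subtracting \<open>c\<close> times the identity keeps the triangular form and lowers
  each diagonal entry by \<open>c\<close>, so bijectivity fails iff \<open>c\<close> is a diagonal
  entry.\<close>

lemma spectrum_tri_op: "spectrum (tri_op k) = range (\<lambda>n. k n n)"
proof -
  have "(\<lambda>a. tri_op k a - scale_af c a) = tri_op (\<lambda>n d. k n d - (if d = n then c else 0))" for c
  proof (intro ext)
    fix a n
    have "(\<Sum>d\<in>divisors_of n - {n}. (k n d - (if d = n then c else 0)) * a d) =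
          (\<Sum>d\<in>divisors_of n - {n}. k n d * a d)"
      by (rule sum.cong) auto
    then show "(tri_op k a - scale_af c a) n = tri_op (\<lambda>n d. k n d - (if d = n then c else 0)) a n"
      by (simp add: tri_op_split scale_af_def left_diff_distrib)
  qed
  then show ?thesis
    by (auto simp: spectrum_def bij_tri_op_iff)
qed

lemma range_nat_of_posnat: "range nat_of_posnat = {N. N \<ge> 1}"
  by (simp add: type_definition.Rep_range[OF type_definition_posnat] Suc_le_eq)

lemma fix_op_eq_tri_op: "fix_op = tri_op (\<lambda>n d. of_nat (nat_of_posnat d))"
  by (simp add: fun_eq_iff fix_op_def tri_op_def)

lemma orb_op_eq_tri_op:
  "orb_op = tri_op (\<lambda>n d. of_int (moebius (nat_of_posnat n div nat_of_posnat d))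
                            / of_nat (nat_of_posnat n))"
  by (simp add: fun_eq_iff orb_op_def tri_op_def sum_divide_distrib)

theorem theorem2p7:
  shows "spectrum fix_op = {(of_nat N :: complex) | N. N \<ge> 1} \<and>
         spectrum orb_op = {1 / (of_nat N :: complex) | N. N \<ge> 1}"
proof -
  have range_comp: "range (\<lambda>n. f (nat_of_posnat n)) = {f N | N. N \<ge> 1}" for f :: "nat \<Rightarrow> complex"
    unfolding image_image[of f nat_of_posnat UNIV, symmetric] range_nat_of_posnat by blast
  \<comment> \<open>The diagonal entry of \<open>orb_op\<close> at \<open>n\<close> is
    \<open>moebius (n div n)\<close> over \<open>n\<close>.\<close>
  have "moebius 1 = 1"
    by (simp add: moebius_def)
  then have "spectrum orb_op = range (\<lambda>n. 1 / of_nat (nat_of_posnat n))"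
    by (simp add: orb_op_eq_tri_op spectrum_tri_op nat_of_posnat_pos)
  moreover have "spectrum fix_op = range (\<lambda>n. of_nat (nat_of_posnat n))"
    by (simp add: fix_op_eq_tri_op spectrum_tri_op)
  ultimately show ?thesis
    by (simp only: range_comp range_comp[of "\<lambda>N. 1 / of_nat N"])
qed

end
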